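(* For $n\ge 3$ let $\gamma(n)=\max\{\gamma(D): D \text{ is a strongly connected directed graph with } n \text{ vertices}\}$, where $\gamma(D)$ is the principal ratio of the stationary distribution of the simple random walk on $D$. Then, as $n\to\infty$, $$\gamma(n)=\left(\frac{2}{3}+o(1)\right)(n-1)!.$$
   Context: Directed graphs are simple: no loops and no multiple edges (for $u\ne v$ both $(u,v)$ and $(v,u)$ may be edges). For a vertex $u$, $d^+(u)$ is its out-degree, i.e. the number of $v$ with $(u,v)\in E(D)$. The simple random walk on $D$ has transition probability matrix $P$ with $P(u,v)=1/d^+(u)$ if $(u,v)\in E(D)$ and $P(u,v)=0$ otherwise. For strongly connected $D$, the Perron vector (stationary distribution) is the unique row vector $\phi$ with positive entries, $\phi P=\phi$ and $\sum_u\phi(u)=1$. The principal ratio is $\gamma(D)=\frac{\max_u\phi(u)}{\min_u\phi(u)}$. *)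

theory Defs
  imports "Graph_Theory.Graph_Theory" "HOL-Library.Landau_Symbols"
begin

definition trans_prob :: "'a pair_pre_digraph \<Rightarrow> 'a \<Rightarrow> 'a \<Rightarrow> real" where
  "trans_prob D u v =
     (if (u, v) \<in> parcs D then 1 / real (out_degree (with_proj D) u) else 0)"

text \<open>
  Row vectors indexed by the vertices are functions on the vertex type; a Perron vector is
  required to vanish off the vertex set so that it is determined by its entries.
\<close>

definition is_perron_vector :: "'a pair_pre_digraph \<Rightarrow> ('a \<Rightarrow> real) \<Rightarrow> bool" where
  "is_perron_vector D \<phi> \<longleftrightarrow>
     (\<forall>u\<in>pverts D. \<phi> u > 0) \<and>
     (\<forall>u. u \<notin> pverts D \<longrightarrow> \<phi> u = 0) \<and>
     (\<forall>v\<in>pverts D. (\<Sum>u\<in>pverts D. \<phi> u * trans_prob D u v) = \<phi> v) \<and>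
     (\<Sum>u\<in>pverts D. \<phi> u) = 1"

text \<open>
  For a strongly connected finite digraph with at least two vertices exactly one Perron vector
  exists; for other digraphs the value below carries no meaning.
\<close>

definition perron_vector :: "'a pair_pre_digraph \<Rightarrow> 'a \<Rightarrow> real" where
  "perron_vector D = (THE \<phi>. is_perron_vector D \<phi>)"

definition principal_ratio :: "'a pair_pre_digraph \<Rightarrow> real" where
  "principal_ratio D =
     Max (perron_vector D ` pverts D) / Min (perron_vector D ` pverts D)"

text \<open>
  The principal ratio does not depend on the names of the vertices, so digraphs with \<open>n\<close> vertices
  are taken on the vertex set \<open>{..<n}\<close>. The locale predicate \<^const>\<open>pair_digraph\<close> says that the
  digraph is finite and loopless; parallel arcs are excluded because arcs are pairs of vertices.
\<close>

definition sc_digraphs :: "nat \<Rightarrow> nat pair_pre_digraph set" where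
  "sc_digraphs n =
     {D. pair_digraph D \<and> strongly_connected (with_proj D) \<and> pverts D = {..<n}}"

lemma finite_sc_digraphs: "finite (sc_digraphs n)"
proof -
  have "sc_digraphs n \<subseteq>
      (\<lambda>E. \<lparr>pverts = {..<n}, parcs = E\<rparr>) ` Pow ({..<n} \<times> {..<n})"
  proof
    fix D assume D: "D \<in> sc_digraphs n"
    then interpret pair_digraph D by (simp add: sc_digraphs_def)
    have "parcs D \<subseteq> {..<n} \<times> {..<n}"
      using D by (auto simp: sc_digraphs_def dest: in_arcsD1 in_arcsD2)
    moreover have "D = \<lparr>pverts = {..<n}, parcs = parcs D\<rparr>"
      using D by (simp add: sc_digraphs_def)
    ultimately show "D \<in> (\<lambda>E. \<lparr>pverts = {..<n}, parcs = E\<rparr>) ` Pow ({..<n} \<times> {..<n})"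
      by blast
  qed
  then show ?thesis by (rule finite_subset) simp
qed

lemma sc_digraphs_nonempty:
  assumes "n \<ge> 1"
  shows "sc_digraphs n \<noteq> {}"
proof -
  let ?D = "\<lparr>pverts = {..<n}, parcs = {(u, v). u < n \<and> v < n \<and> u \<noteq> v}\<rparr>"
  have "finite {(u, v). u < n \<and> v < n \<and> u \<noteq> v}"
    by (rule finite_subset[of _ "{..<n} \<times> {..<n}"]) auto
  then interpret pair_digraph ?D by unfold_locales auto
  have "u \<rightarrow>\<^sup>*\<^bsub>with_proj ?D\<^esub> v" if "u < n" "v < n" for u v
    using that by (cases "u = v") auto
  then have "strongly_connected (with_proj ?D)"
    using assms by (auto simp: strongly_connected_def lessThan_empty_iff)
  then have "?D \<in> sc_digraphs n"
    using pair_digraph_axioms by (simp add: sc_digraphs_def)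
  then show ?thesis by blast
qed

definition max_principal_ratio :: "nat \<Rightarrow> real" where
  "max_principal_ratio n = Max (principal_ratio ` sc_digraphs n)"

end

theory Submission
  imports Defs "Jordan_Normal_Form.Determinant"
begin

text \<open>
  The asymptotics follow from the exact value
  \<open>\<gamma>(n) = 2/3 \<cdot> (1! + 2! + \<dots> + (n - 1)!)\<close> for \<open>n \<ge> 3\<close> (\<open>max_principal_ratio_eq\<close>), since the
  last factorial dominates the sum.

  The exact value rests on duality. If \<open>\<phi>\<close> is stationary, then for every function \<open>g\<close> on the
  vertices the drifts \<open>P g (v) - g v\<close>, weighted by \<open>\<phi> v\<close>, sum to zero (\<open>stationary_drift\<close>). So
  if the drift of \<open>g\<close> is nonnegative at all vertices but \<open>w\<close>, at least \<open>p > 0\<close> at \<open>u\<close>, and at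
  least \<open>- q\<close> at \<open>w\<close>, then \<open>\<phi> u / \<phi> w \<le> q / p\<close>. No path from \<open>u\<close> to \<open>w\<close> has to be followed and no
  linear system for \<open>\<phi>\<close> has to be solved.

  Let \<open>w\<close> minimise \<open>\<phi>\<close> and \<open>u\<close> maximise it. Give each vertex the height \<open>n\<close> minus its distance to
  \<open>w\<close>. Every vertex other than \<open>w\<close> has an out-neighbour one level higher, and since all distances
  up to the largest one occur, at most \<open>j\<close> vertices have height at most \<open>j\<close>
  (\<open>height_function\<close>). For \<open>g\<close> a monotone function of the height, the drift at a vertex of
  height \<open>q\<close> is therefore smallest when the vertex points to everything below it and the heights
  below are \<open>1, \<dots>, q - 1\<close>. Making this extreme drift vanish at all heights above the height \<open>a\<close>
  of \<open>u\<close> leaves a recurrence for the increments of \<open>g\<close>, solved by multiples of factorials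
  (\<open>pot_step\<close>, \<open>weighted_pot_steps\<close>). The resulting bound on \<open>\<phi> u / \<phi> w\<close> depends on \<open>a\<close> only and
  is largest for \<open>a = 2\<close> (\<open>pot_le_fact_sum\<close>), where it is the value above.

  Equality holds for the digraph with arcs \<open>k \<rightarrow> k + 1\<close>, all arcs \<open>k \<rightarrow> l\<close> with \<open>l < k < n - 1\<close>,
  and \<open>n - 1 \<rightarrow> 0\<close>: there the drift of the potential for \<open>a = 2\<close> vanishes except at \<open>1\<close> and
  \<open>n - 1\<close>, so the ratio of these two entries is read off from the same identity.

  Everything presupposes that the Perron vector exists and is unique. It is obtained from a
  left kernel vector of \<open>P - I\<close> by taking absolute values.
\<close>

section \<open>Left fixed vectors of stochastic kernels\<close>

text \<open>
  The constant vector is a right fixed vector, so \<open>K - I\<close> is singular, and then so is its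
  transpose. An enumeration of \<open>V\<close> carries this determinant argument over to kernels indexed by
  an arbitrary finite set.
\<close>
lemma stochastic_left_fixed_vector:
  fixes K :: "'a \<Rightarrow> 'a \<Rightarrow> real"
  assumes fin: "finite V" and ne: "V \<noteq> {}" and row: "\<And>u. u \<in> V \<Longrightarrow> (\<Sum>v\<in>V. K u v) = 1"
  shows "\<exists>x. (\<exists>v\<in>V. x v \<noteq> 0) \<and> (\<forall>v\<in>V. (\<Sum>u\<in>V. x u * K u v) = x v)"
proof -
  define n where "n = card V"
  obtain e where e: "bij_betw e {0..<n} V"
    using ex_bij_betw_nat_finite[OF fin] n_def by blast
  have n: "n > 0"
    using fin ne by (simp add: n_def card_gt_0_iff)
  have eV: "e i \<in> V" if "i < n" for i
    using e that by (auto simp: bij_betw_def)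
  define A where "A = mat n n (\<lambda>(i, j). K (e i) (e j) - (if i = j then 1 else 0))"
  have A: "A \<in> carrier_mat n n"
    by (simp add: A_def)
  define c where "c = vec n (\<lambda>_. 1 :: real)"
  have "A *\<^sub>v c = 0\<^sub>v n"
  proof (rule eq_vecI)
    fix i assume "i < dim_vec (0\<^sub>v n :: real vec)"
    then have i: "i < n" by simp
    have "(A *\<^sub>v c) $ i = (\<Sum>j\<in>{0..<n}. K (e i) (e j) - (if i = j then 1 else 0))"
      using i by (simp add: A_def c_def scalar_prod_def)
    also have "\<dots> = (\<Sum>j\<in>{0..<n}. K (e i) (e j)) - 1"
      using i by (simp add: sum_subtractf)
    also have "(\<Sum>j\<in>{0..<n}. K (e i) (e j)) = (\<Sum>v\<in>V. K (e i) v)"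
      by (rule sum.reindex_bij_betw[OF e])
    finally show "(A *\<^sub>v c) $ i = 0\<^sub>v n $ i"
      using row[OF eV[OF i]] i by simp
  qed (simp add: A_def)
  moreover have "c \<noteq> 0\<^sub>v n"
    using n by (metis c_def index_vec index_zero_vec(1) zero_neq_one)
  moreover have "c \<in> carrier_vec n"
    by (simp add: c_def)
  ultimately have "det A = 0"
    using det_0_iff_vec_prod_zero_field[OF A] by blast
  then have "det (transpose_mat A) = 0"
    using det_transpose[OF A] by simp
  then obtain y where y: "y \<in> carrier_vec n" "y \<noteq> 0\<^sub>v n" "transpose_mat A *\<^sub>v y = 0\<^sub>v n"
    using det_0_iff_vec_prod_zero_field[of "transpose_mat A" n] A by auto
  define x where "x v = y $ the_inv_into {0..<n} e v" for v
  have xe: "x (e i) = y $ i" if "i < n" for i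
    using e that by (simp add: x_def bij_betw_def the_inv_into_f_f)
  show ?thesis
  proof (intro exI[of _ x] conjI ballI)
    obtain i where "i < n" "y $ i \<noteq> 0"
      using y(1,2) by (metis carrier_vecD eq_vecI index_zero_vec)
    then show "\<exists>v\<in>V. x v \<noteq> 0"
      using eV xe by metis
  next
    fix v assume "v \<in> V"
    then obtain j where j: "j < n" "v = e j"
      using e by (auto simp: bij_betw_def)
    have "0 = (transpose_mat A *\<^sub>v y) $ j"
      using y(3) j by simp
    also have "\<dots> = (\<Sum>i\<in>{0..<n}. (K (e i) (e j) - (if i = j then 1 else 0)) * y $ i)"
      using j y(1) by (simp add: A_def scalar_prod_def)
    also have "\<dots> = (\<Sum>i\<in>{0..<n}. x (e i) * K (e i) (e j) - (if i = j then x (e i) else 0))"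
      by (rule sum.cong) (auto simp: xe algebra_simps)
    also have "\<dots> = (\<Sum>i\<in>{0..<n}. x (e i) * K (e i) (e j)) - x v"
      using j by (simp add: sum_subtractf)
    also have "(\<Sum>i\<in>{0..<n}. x (e i) * K (e i) (e j)) = (\<Sum>u\<in>V. x u * K u v)"
      unfolding j(2) by (rule sum.reindex_bij_betw[OF e])
    finally show "(\<Sum>u\<in>V. x u * K u v) = x v" by simp
  qed
qed

section \<open>The Perron vector of a strongly connected digraph\<close>

text \<open>
  With at least two vertices, strong connectivity gives every vertex an out-neighbour, so that
  \<^const>\<open>trans_prob\<close> is a stochastic kernel.
\<close>
locale walk_digraph = pair_digraph D for D :: "'a pair_pre_digraph" +
  assumes sc: "strongly_connected (with_proj D)"
    and two_vertices: "card (pverts D) \<ge> 2"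
begin

definition out_nbrs :: "'a \<Rightarrow> 'a set" where
  "out_nbrs u = {v. (u, v) \<in> parcs D}"

text \<open>
  Stationarity alone, without positivity or normalisation: it is preserved by linear combinations
  and by absolute values.
\<close>
definition stationary :: "('a \<Rightarrow> real) \<Rightarrow> bool" where
  "stationary x \<longleftrightarrow> (\<forall>v\<in>pverts D. (\<Sum>u\<in>pverts D. x u * trans_prob D u v) = x v)"

lemma out_nbrs_subset: "out_nbrs u \<subseteq> pverts D"
  by (auto simp: out_nbrs_def dest: in_arcsD2)

lemma finite_out_nbrs: "finite (out_nbrs u)"
  using out_nbrs_subset pair_finite_verts by (rule finite_subset)

lemma trans_prob_eq:
  "trans_prob D u v = (if v \<in> out_nbrs u then 1 / real (card (out_nbrs u)) else 0)"
proof -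
  have "out_arcs (with_proj D) u = Pair u ` out_nbrs u"
    by (auto simp: out_arcs_def out_nbrs_def)
  then have "out_degree (with_proj D) u = card (out_nbrs u)"
    by (simp add: out_degree_def card_image inj_on_def)
  then show ?thesis
    by (simp add: trans_prob_def out_nbrs_def)
qed

lemma trans_prob_nonneg: "trans_prob D u v \<ge> 0"
  by (simp add: trans_prob_eq)

lemma reachable_verts:
  assumes "u \<in> pverts D" "v \<in> pverts D"
  shows "(u, v) \<in> rtrancl_on (pverts D) (parcs D)"
  using sc assms by (auto simp: strongly_connected_def reachable_def)

lemma out_nbrs_nonempty:
  assumes u: "u \<in> pverts D"
  shows "out_nbrs u \<noteq> {}"
proof -
  obtain v where v: "v \<in> pverts D" "v \<noteq> u"
  proof -
    have "\<not> card (pverts D) \<le> Suc 0"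
      using two_vertices by simp
    then show thesis
      using that u pair_finite_verts by (auto simp: card_le_Suc0_iff_eq)
  qed
  from reachable_verts[OF u v(1)] v(2) show ?thesis
    by (cases rule: converse_rtrancl_on_cases) (auto simp: out_nbrs_def)
qed

lemma out_degree_pos: "u \<in> pverts D \<Longrightarrow> card (out_nbrs u) > 0"
  using out_nbrs_nonempty finite_out_nbrs by (simp add: card_gt_0_iff)

lemma sum_trans_prob_mult:
  "(\<Sum>v\<in>pverts D. trans_prob D u v * g v) = (\<Sum>v\<in>out_nbrs u. g v) / real (card (out_nbrs u))"
proof -
  have "(\<Sum>v\<in>pverts D. trans_prob D u v * g v) = (\<Sum>v\<in>out_nbrs u. trans_prob D u v * g v)"
    by (rule sum.mono_neutral_right)
      (use pair_finite_verts out_nbrs_subset in \<open>auto simp: trans_prob_eq\<close>)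
  also have "\<dots> = (\<Sum>v\<in>out_nbrs u. g v / real (card (out_nbrs u)))"
    by (rule sum.cong) (simp_all add: trans_prob_eq)
  finally show ?thesis by (simp add: sum_divide_distrib)
qed

lemma sum_trans_prob: "u \<in> pverts D \<Longrightarrow> (\<Sum>v\<in>pverts D. trans_prob D u v) = 1"
  using sum_trans_prob_mult[of u "\<lambda>_. 1"] out_degree_pos[of u] by simp

text \<open>
  The duality behind both bounds: the pairing of \<open>x\<close> with \<open>P g - g\<close> equals that of \<open>x P - x = 0\<close>
  with \<open>g\<close>. The drift \<open>P g - g\<close> is written as the average increment of \<open>g\<close> over the
  out-neighbours.
\<close>
lemma stationary_drift:
  assumes x: "stationary x"
  shows "(\<Sum>u\<in>pverts D. x u * ((\<Sum>v\<in>out_nbrs u. g v - g u) / real (card (out_nbrs u)))) = 0"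
proof -
  have "(\<Sum>u\<in>pverts D. x u * ((\<Sum>v\<in>out_nbrs u. g v - g u) / real (card (out_nbrs u))))
      = (\<Sum>u\<in>pverts D. x u * (\<Sum>v\<in>pverts D. trans_prob D u v * g v) - x u * g u)"
  proof (rule sum.cong)
    fix u assume "u \<in> pverts D"
    then show "x u * ((\<Sum>v\<in>out_nbrs u. g v - g u) / real (card (out_nbrs u)))
        = x u * (\<Sum>v\<in>pverts D. trans_prob D u v * g v) - x u * g u"
      using out_degree_pos[of u] unfolding sum_trans_prob_mult
      by (simp add: sum_subtractf field_simps)
  qed simp
  also have "\<dots> = (\<Sum>u\<in>pverts D. \<Sum>v\<in>pverts D. x u * trans_prob D u v * g v)
      - (\<Sum>u\<in>pverts D. x u * g u)"
    by (simp add: sum_subtractf sum_distrib_left mult.assoc)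
  also have "(\<Sum>u\<in>pverts D. \<Sum>v\<in>pverts D. x u * trans_prob D u v * g v)
      = (\<Sum>v\<in>pverts D. (\<Sum>u\<in>pverts D. x u * trans_prob D u v) * g v)"
    by (subst sum.swap) (simp add: sum_distrib_right)
  also have "\<dots> = (\<Sum>u\<in>pverts D. x u * g u)"
    using x by (intro sum.cong) (simp_all add: stationary_def)
  finally show ?thesis by simp
qed

text \<open>Positive mass at \<open>u\<close> flows along a walk to every other vertex.\<close>
lemma stationary_pos:
  assumes x: "stationary x" and nn: "\<And>v. v \<in> pverts D \<Longrightarrow> x v \<ge> 0"
    and u: "u \<in> pverts D" "x u > 0" and v: "v \<in> pverts D"
  shows "x v > 0"
  using reachable_verts[OF u(1) v]
proof (induction rule: rtrancl_on_induct)
  case base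
  then show ?case using u by simp
next
  case (step y z)
  have "0 < x y * trans_prob D y z"
    using step out_degree_pos[of y] by (simp add: trans_prob_eq out_nbrs_def)
  also have "\<dots> \<le> (\<Sum>u\<in>pverts D. x u * trans_prob D u z)"
    by (rule member_le_sum) (use step nn trans_prob_nonneg pair_finite_verts in auto)
  also have "\<dots> = x z"
    using x step by (simp add: stationary_def)
  finally show ?case .
qed

text \<open>
  The triangle inequality gives \<open>|x| \<le> |x| P\<close> at every vertex. Both sides have the same total
  because \<open>P\<close> preserves mass, so no inequality can be strict.
\<close>
lemma stationary_abs:
  assumes x: "stationary x"
  shows "stationary (\<lambda>v. \<bar>x v\<bar>)"
proof -
  let ?y = "\<lambda>v. \<Sum>u\<in>pverts D. \<bar>x u\<bar> * trans_prob D u v"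
  have le: "\<bar>x v\<bar> \<le> ?y v" if "v \<in> pverts D" for v
  proof -
    have "\<bar>x v\<bar> = \<bar>\<Sum>u\<in>pverts D. x u * trans_prob D u v\<bar>"
      using x that by (simp add: stationary_def)
    also have "\<dots> \<le> (\<Sum>u\<in>pverts D. \<bar>x u * trans_prob D u v\<bar>)"
      by (rule sum_abs)
    finally show ?thesis
      by (simp add: abs_mult trans_prob_nonneg)
  qed
  have "(\<Sum>v\<in>pverts D. ?y v) = (\<Sum>u\<in>pverts D. \<bar>x u\<bar> * (\<Sum>v\<in>pverts D. trans_prob D u v))"
    by (subst sum.swap) (simp add: sum_distrib_left)
  also have "\<dots> = (\<Sum>u\<in>pverts D. \<bar>x u\<bar>)"
    by (intro sum.cong) (simp_all add: sum_trans_prob)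
  finally have "(\<Sum>v\<in>pverts D. ?y v - \<bar>x v\<bar>) = 0"
    by (simp add: sum_subtractf)
  then have "\<forall>v\<in>pverts D. ?y v - \<bar>x v\<bar> = 0"
    using le pair_finite_verts by (subst (asm) sum_nonneg_eq_0_iff) auto
  then show ?thesis
    by (simp add: stationary_def)
qed

lemma perron_vector_exists: "\<exists>\<phi>. is_perron_vector D \<phi>"
proof -
  have ne: "pverts D \<noteq> {}"
    using two_vertices by auto
  obtain x where x: "\<exists>v\<in>pverts D. x v \<noteq> 0"
      and xP: "\<forall>v\<in>pverts D. (\<Sum>u\<in>pverts D. x u * trans_prob D u v) = x v"
    using stochastic_left_fixed_vector[OF pair_finite_verts ne, of "trans_prob D"] sum_trans_prob
    by blast
  have st: "stationary (\<lambda>v. \<bar>x v\<bar>)"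
    by (rule stationary_abs) (simp add: stationary_def xP)
  from x obtain u where u: "u \<in> pverts D" "\<bar>x u\<bar> > 0" by auto
  have pos: "\<bar>x v\<bar> > 0" if "v \<in> pverts D" for v
    using stationary_pos[OF st _ u that] by simp
  define s where "s = (\<Sum>v\<in>pverts D. \<bar>x v\<bar>)"
  have s: "s > 0"
    unfolding s_def using pos ne pair_finite_verts by (intro sum_pos) auto
  have "is_perron_vector D (\<lambda>v. if v \<in> pverts D then \<bar>x v\<bar> / s else 0)"
    unfolding is_perron_vector_def
  proof (intro conjI ballI allI impI)
    fix v assume v: "v \<in> pverts D"
    then show "0 < (if v \<in> pverts D then \<bar>x v\<bar> / s else 0)"
      using pos s by simp
    have "(\<Sum>u\<in>pverts D. (if u \<in> pverts D then \<bar>x u\<bar> / s else 0) * trans_prob D u v)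
        = (\<Sum>u\<in>pverts D. \<bar>x u\<bar> * trans_prob D u v) / s"
      unfolding sum_divide_distrib by (intro sum.cong) simp_all
    then show "(\<Sum>u\<in>pverts D. (if u \<in> pverts D then \<bar>x u\<bar> / s else 0) * trans_prob D u v)
        = (if v \<in> pverts D then \<bar>x v\<bar> / s else 0)"
      using st v by (simp add: stationary_def)
  next
    have "(\<Sum>u\<in>pverts D. if u \<in> pverts D then \<bar>x u\<bar> / s else 0) = s / s"
      unfolding s_def sum_divide_distrib by (intro sum.cong) simp_all
    then show "(\<Sum>u\<in>pverts D. if u \<in> pverts D then \<bar>x u\<bar> / s else 0) = 1"
      using s by simp
  qed simp
  then show ?thesis by blast
qed

text \<open>
  Subtracting from \<open>\<phi>\<close> the largest multiple of \<open>\<psi>\<close> that keeps the difference nonnegative gives a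
  nonnegative stationary vector with a zero entry. Such a vector vanishes, so \<open>\<phi>\<close> is a multiple
  of \<open>\<psi>\<close>, and the normalisation makes the factor 1.
\<close>
lemma perron_vector_unique:
  assumes \<phi>: "is_perron_vector D \<phi>" and \<psi>: "is_perron_vector D \<psi>"
  shows "\<phi> = \<psi>"
proof -
  have ne: "pverts D \<noteq> {}"
    using two_vertices by auto
  define t where "t = Min ((\<lambda>v. \<phi> v / \<psi> v) ` pverts D)"
  have "t \<in> (\<lambda>v. \<phi> v / \<psi> v) ` pverts D"
    unfolding t_def by (rule Min_in) (use pair_finite_verts ne in auto)
  then obtain w where w: "w \<in> pverts D" "t = \<phi> w / \<psi> w" by auto
  have \<psi>pos: "\<psi> v > 0" if "v \<in> pverts D" for v
    using \<psi> that by (simp add: is_perron_vector_def)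
  define x where "x v = \<phi> v - t * \<psi> v" for v
  have nn: "x v \<ge> 0" if "v \<in> pverts D" for v
  proof -
    have "t \<le> \<phi> v / \<psi> v"
      unfolding t_def by (rule Min_le) (use pair_finite_verts that in auto)
    then show ?thesis
      using \<psi>pos[OF that] by (simp add: x_def field_simps)
  qed
  have "stationary x"
    unfolding stationary_def
  proof
    fix v assume "v \<in> pverts D"
    then have "\<phi> v = (\<Sum>u\<in>pverts D. \<phi> u * trans_prob D u v)"
      and "\<psi> v = (\<Sum>u\<in>pverts D. \<psi> u * trans_prob D u v)"
      using \<phi> \<psi> by (simp_all add: is_perron_vector_def)
    then show "(\<Sum>u\<in>pverts D. x u * trans_prob D u v) = x v"
      by (simp add: x_def left_diff_distrib sum_subtractf sum_distrib_left mult.assoc)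
  qed
  moreover have "x w = 0"
    using w \<psi>pos[OF w(1)] by (simp add: x_def)
  ultimately have x0: "x v = 0" if "v \<in> pverts D" for v
    using stationary_pos[of x v w] nn that w(1) by (metis less_irrefl order_le_less)
  have "0 = (\<Sum>v\<in>pverts D. x v)"
    using x0 by simp
  also have "\<dots> = 1 - t"
    using \<phi> \<psi> by (simp add: x_def sum_subtractf is_perron_vector_def flip: sum_distrib_left)
  finally have "t = 1" by simp
  show ?thesis
  proof
    fix v show "\<phi> v = \<psi> v"
      using x0[of v] \<open>t = 1\<close> \<phi> \<psi> by (cases "v \<in> pverts D") (auto simp: x_def is_perron_vector_def)
  qed
qed

lemma is_perron_vector_perron_vector: "is_perron_vector D (perron_vector D)"
proof -
  obtain \<phi> where \<phi>: "is_perron_vector D \<phi>"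
    using perron_vector_exists by blast
  then show ?thesis
    unfolding perron_vector_def
    by (rule theI[where P = "is_perron_vector D"]) (rule perron_vector_unique[OF _ \<phi>])
qed

lemma perron_vector_pos: "v \<in> pverts D \<Longrightarrow> perron_vector D v > 0"
  using is_perron_vector_perron_vector by (simp add: is_perron_vector_def)

lemma stationary_perron_vector: "stationary (perron_vector D)"
  using is_perron_vector_perron_vector by (simp add: is_perron_vector_def stationary_def)


section \<open>Heights towards a target vertex\<close>

text \<open>
  The height is the number of vertices minus the distance to \<open>w\<close>. A vertex at distance \<open>d\<close> sees
  all distances \<open>0, \<dots>, d\<close> on a shortest walk to \<open>w\<close>. So whenever some vertex has height at most
  \<open>j\<close>, that is, distance at least \<open>n - j\<close>, there are at least \<open>n - j\<close> vertices at smaller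
  distances, which leaves at most \<open>j\<close> of height at most \<open>j\<close>. The bound for \<open>j = 0\<close> says that all
  heights are positive.
\<close>
lemma height_function:
  assumes w: "w \<in> pverts D"
  shows "\<exists>h :: 'a \<Rightarrow> nat. h w = card (pverts D) \<and>
    (\<forall>v\<in>pverts D - {w}. h v < card (pverts D)) \<and>
    (\<forall>v\<in>pverts D - {w}. \<exists>y\<in>out_nbrs v. h y = Suc (h v)) \<and>
    (\<forall>j. card {v \<in> pverts D. h v \<le> j} \<le> j)"
proof -
  define r where "r v = (LEAST k. (v, w) \<in> parcs D ^^ k)" for v
  have walk: "(v, w) \<in> parcs D ^^ r v" if "v \<in> pverts D" for v
  proof -
    have "(v, w) \<in> (parcs D)\<^sup>*"
      using reachable_verts[OF that w] by (rule rtrancl_on_rtranclI)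
    then show ?thesis
      unfolding r_def rtrancl_power by (rule LeastI_ex)
  qed
  have least: "r v \<le> k" if "(v, w) \<in> parcs D ^^ k" for v k
    unfolding r_def using that by (rule Least_le)
  have rw: "r w = 0"
    using least[of w 0] by simp
  have r0: "v = w" if "v \<in> pverts D" "r v = 0" for v
    using walk[OF that(1)] that(2) by simp
  have closer: "\<exists>y\<in>out_nbrs v. r y = m" if v: "v \<in> pverts D" and m: "r v = Suc m" for v m
  proof -
    have "(v, w) \<in> parcs D ^^ Suc m"
      using walk[OF v] m by simp
    then obtain y where y: "(v, y) \<in> parcs D" "(y, w) \<in> parcs D ^^ m"
      by (metis relpow_Suc_D2)
    have "(y, w) \<in> parcs D ^^ r y"
      using walk in_arcsD2[OF y(1)] by blast
    then have "(v, w) \<in> parcs D ^^ Suc (r y)"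
      using y(1) by (rule relpow_Suc_I2[rotated])
    then have "Suc m \<le> Suc (r y)"
      using least m by metis
    moreover have "r y \<le> m"
      using y(2) by (rule least)
    ultimately show ?thesis
      using y(1) by (auto simp: out_nbrs_def)
  qed
  have attained: "\<exists>y\<in>pverts D. r y = k" if "v \<in> pverts D" "k \<le> r v" for v k
    using that
  proof (induction "r v - k" arbitrary: v)
    case 0
    then show ?case by auto
  next
    case (Suc d)
    then obtain m where m: "r v = Suc m"
      by (cases "r v") auto
    then obtain y where y: "y \<in> out_nbrs v" "r y = m"
      using closer Suc by blast
    show ?case
      by (rule Suc(1)[of y]) (use Suc m y out_nbrs_subset in auto)
  qed
  have lt_card: "card {v \<in> pverts D. r v < k} \<ge> k" if "v \<in> pverts D" "k \<le> Suc (r v)" for v k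
  proof -
    have "{..<k} \<subseteq> r ` {v \<in> pverts D. r v < k}"
    proof
      fix i assume "i \<in> {..<k}"
      then show "i \<in> r ` {v \<in> pverts D. r v < k}"
        using attained[OF that(1), of i] that(2) by force
    qed
    then have "card {..<k} \<le> card {v \<in> pverts D. r v < k}"
      by (rule surj_card_le[rotated]) (simp add: pair_finite_verts)
    then show ?thesis by simp
  qed
  let ?n = "card (pverts D)"
  have rn: "r v < ?n" if "v \<in> pverts D" for v
  proof -
    have "Suc (r v) \<le> card {v' \<in> pverts D. r v' < Suc (r v)}"
      using lt_card[OF that] by simp
    also have "\<dots> \<le> ?n"
      by (rule card_mono) (auto simp: pair_finite_verts)
    finally show ?thesis by simp
  qed
  define h where "h v = ?n - r v" for v
  show ?thesis
  proof (intro exI[of _ h] conjI ballI allI)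
    show "h w = ?n"
      by (simp add: h_def rw)
  next
    fix v assume v: "v \<in> pverts D - {w}"
    then show "h v < ?n"
      using rn[of v] r0[of v] by (cases "r v") (auto simp: h_def)
  next
    fix v assume v: "v \<in> pverts D - {w}"
    then obtain m where m: "r v = Suc m"
      using r0[of v] by (cases "r v") auto
    then obtain y where "y \<in> out_nbrs v" "r y = m"
      using closer v by blast
    then show "\<exists>y\<in>out_nbrs v. h y = Suc (h v)"
      using m rn[of v] v by (intro bexI[of _ y]) (auto simp: h_def)
  next
    fix j
    show "card {v \<in> pverts D. h v \<le> j} \<le> j"
    proof (cases "{v \<in> pverts D. h v \<le> j} = {}")
      case True
      show ?thesis unfolding True by simp
    next
      case False
      then obtain v where v: "v \<in> pverts D" "h v \<le> j" by blast
      have "card {v \<in> pverts D. h v \<le> j} + card {v \<in> pverts D. r v < ?n - j} = ?n"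
      proof (subst card_Un_disjoint[symmetric])
        show "card ({v \<in> pverts D. h v \<le> j} \<union> {v \<in> pverts D. r v < ?n - j}) = ?n"
          by (rule arg_cong[of _ _ card]) (auto simp: h_def)
      qed (use rn in \<open>force simp: h_def pair_finite_verts\<close>)+
      moreover have "?n - j \<le> card {v \<in> pverts D. r v < ?n - j}"
        using v by (intro lt_card[of v]) (auto simp: h_def)
      ultimately show ?thesis
        by linarith
    qed
  qed
qed

end

section \<open>The potential\<close>

text \<open>
  The increment of the potential from height \<open>j\<close> to height \<open>j + 1\<close>. Up to scaling, this is the
  solution \<open>D\<close> of \<open>D q = (\<Sum>j<q. j * D j)\<close> for \<open>q > a\<close> that vanishes below \<open>a\<close>; the value
  \<open>(a + 1)!\<close> at \<open>a\<close> is chosen to clear the denominator of the later ones.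
\<close>
definition pot_step :: "nat \<Rightarrow> nat \<Rightarrow> real" where
  "pot_step a j = (if j < a then 0 else if j = a then fact (a + 1) else real a * fact j)"

definition pot :: "nat \<Rightarrow> nat \<Rightarrow> real" where
  "pot a q = (\<Sum>j<q. pot_step a j)"

lemma pot_step_nonneg: "pot_step a j \<ge> 0"
  by (simp add: pot_step_def)

lemma pot_Suc: "pot a (Suc q) = pot a q + pot_step a q"
  by (simp add: pot_def)

lemma pot_mono: "p \<le> q \<Longrightarrow> pot a p \<le> pot a q"
  unfolding pot_def by (rule sum_mono2) (auto simp: pot_step_nonneg)

lemma pot_nonneg: "pot a q \<ge> 0"
  unfolding pot_def by (simp add: sum_nonneg pot_step_nonneg)

lemma pot_eq_0: "q \<le> a \<Longrightarrow> pot a q = 0"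
  by (simp add: pot_def pot_step_def)

text \<open>
  The sum telescopes because \<open>j * j! = (j + 1)! - j!\<close>. It is the worst possible loss of potential
  over the arcs that do not lead upwards from height \<open>q\<close> (\<open>sum_pot_deficit_le\<close>), and so the
  single upward arc always makes up for it.
\<close>
lemma weighted_pot_steps:
  assumes "a < q"
  shows "(\<Sum>j<q. real j * pot_step a j) = pot_step a q"
proof -
  have "(\<Sum>j<q. real j * pot_step a j) = real a * fact q"
    using Suc_leI[OF assms]
  proof (induction q rule: dec_induct)
    case base
    then show ?case by (simp add: pot_step_def)
  next
    case (step q)
    then show ?case by (simp add: pot_step_def algebra_simps)
  qed
  then show ?thesis
    using assms by (simp add: pot_step_def)
qed

text \<open>
  Summation by parts: the step from \<open>j\<close> to \<open>j + 1\<close> is lost once for every vertex of height at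
  most \<open>j\<close>, hence at most \<open>j\<close> times.
\<close>
lemma sum_pot_deficit_le:
  assumes A: "finite A" and count: "\<And>j. card {x \<in> A. h x \<le> j} \<le> j"
  shows "(\<Sum>x\<in>A. pot a q - pot a (h x)) \<le> (\<Sum>j<q. real j * pot_step a j)"
proof -
  have single: "pot a q - pot a p \<le> (\<Sum>j<q. if p \<le> j then pot_step a j else 0)" for p
  proof -
    have "pot a q = (\<Sum>j<q. if p \<le> j then pot_step a j else 0)
        + (\<Sum>j<q. if p \<le> j then 0 else pot_step a j)"
      unfolding pot_def sum.distrib[symmetric] by (rule sum.cong) auto
    also have "(\<Sum>j<q. if p \<le> j then 0 else pot_step a j)
        = (\<Sum>j\<in>{..<q} \<inter> {..<p}. pot_step a j)"
      by (simp add: sum.inter_restrict if_distrib not_le[symmetric] cong: if_cong) (meson not_le)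
    also have "\<dots> \<le> pot a p"
      unfolding pot_def by (rule sum_mono2) (auto simp: pot_step_nonneg)
    finally show ?thesis by simp
  qed
  have "(\<Sum>x\<in>A. pot a q - pot a (h x)) \<le> (\<Sum>x\<in>A. \<Sum>j<q. if h x \<le> j then pot_step a j else 0)"
    by (rule sum_mono) (rule single)
  also have "\<dots> = (\<Sum>j<q. \<Sum>x\<in>A. if h x \<le> j then pot_step a j else 0)"
    by (rule sum.swap)
  also have "\<dots> = (\<Sum>j<q. real (card {x \<in> A. h x \<le> j}) * pot_step a j)"
    using A by (simp add: sum.inter_filter[symmetric])
  also have "\<dots> \<le> (\<Sum>j<q. real j * pot_step a j)"
    using count by (intro sum_mono mult_right_mono) (auto simp: pot_step_nonneg)
  finally show ?thesis .
qed

definition fact_sum :: "nat \<Rightarrow> real" where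
  "fact_sum m = (\<Sum>j=1..m. fact j)"

lemma fact_sum_Suc: "fact_sum (Suc m) = fact_sum m + fact (Suc m)"
  by (simp add: fact_sum_def)

text \<open>
  The next two inequalities are the base case and the induction step of \<open>pot_le_fact_sum\<close>. Both
  are equalities at \<open>a = 2\<close>; the first fails at \<open>a = 1\<close>, which therefore needs a separate
  induction.
\<close>
lemma fact_sum_ge_linear:
  assumes "a \<ge> 2"
  shows "3 * real a \<le> 2 * fact_sum a"
  using assms
proof (induction a rule: dec_induct)
  case base
  then show ?case by (simp add: fact_sum_def numeral_2_eq_2)
next
  case (step a)
  have "(2 :: real) \<le> fact (Suc a)"
    using fact_mono[of 2 "Suc a", where 'a = real] step by simp
  then show ?case
    using step by (simp add: fact_sum_Suc)
qed

lemma three_squares_le_fact: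
  assumes "a \<ge> 2"
  shows "3 * real a * real a \<le> 2 * fact (a + 1)"
  using assms
proof (induction a rule: dec_induct)
  case base
  then show ?case by (simp add: fact_numeral)
next
  case (step a)
  have "real a + 1 \<le> real a * real a" 
  proof -
    have "2 \<le> real a"
      using step by simp
    then show ?thesis
      using mult_right_mono[of 2 "real a" "real a"] by linarith
  qed
  then have "(real a + 1) * (real a + 1) \<le> real a * real a * (real a + 2)"
    using mult_mono[of "real a + 1" "real a * real a" "real a + 1" "real a + 2"] by simp
  then have "3 * real (Suc a) * real (Suc a) \<le> (real a + 2) * (3 * real a * real a)"
    by (simp add: algebra_simps)
  also have "\<dots> \<le> (real a + 2) * (2 * fact (a + 1))"
    using step by (intro mult_left_mono) simp_all
  also have "\<dots> = 2 * fact (Suc a + 1)"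
    by (simp add: algebra_simps)
  finally show ?case .
qed

text \<open>
  For \<open>u\<close> at height \<open>a\<close> the duality argument yields the ratio \<open>a * pot a n / (a + 1)!\<close>. Among all
  heights the worst one is \<open>a = 2\<close>, for which this is an equality by \<open>pot_2_eq_fact_sum\<close>. For
  \<open>a = 1\<close> the leading coefficient is only \<open>1/2\<close>, but the comparison then needs \<open>m \<ge> 2\<close> to
  absorb the lower-order terms.
\<close>
lemma pot_le_fact_sum:
  assumes "1 \<le> a" "a \<le> m" "2 \<le> m"
  shows "3 * real a * pot a (Suc m) \<le> 2 * fact (a + 1) * fact_sum m"
proof (cases "a = 1")
  case True
  have "3 * pot 1 (Suc m) \<le> 4 * fact_sum m"
    using assms(3)
  proof (induction m rule: dec_induct)
    case base
    then show ?case by (simp add: pot_def pot_step_def fact_sum_def numeral_2_eq_2)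
  next
    case (step m)
    have "pot_step 1 (Suc m) = fact (Suc m)"
      using step by (simp add: pot_step_def)
    then have "3 * pot 1 (Suc (Suc m)) = 3 * pot 1 (Suc m) + 3 * fact (Suc m)"
      by (simp only: pot_Suc[of _ "Suc m"] distrib_left)
    also have "\<dots> \<le> 4 * fact_sum m + 4 * fact (Suc m)"
      by (intro add_mono step.IH mult_right_mono) simp_all
    finally show ?case
      by (simp only: fact_sum_Suc distrib_left)
  qed
  then show ?thesis
    using True by simp
next
  case False
  then have a: "a \<ge> 2"
    using assms by simp
  show ?thesis
    using assms(2)
  proof (induction m rule: dec_induct)
    case base
    have "pot a (Suc a) = fact (a + 1)"
      by (simp add: pot_Suc pot_eq_0 pot_step_def)
    then show ?case
      using mult_left_mono[OF fact_sum_ge_linear[OF a], of "fact (a + 1)"]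
      by (simp add: algebra_simps)
  next
    case (step m)
    have "3 * real a * pot_step a (Suc m) \<le> 2 * fact (a + 1) * fact (Suc m)"
      using mult_right_mono[OF three_squares_le_fact[OF a], of "fact (Suc m)"] step
      by (simp add: pot_step_def algebra_simps)
    then show ?case
      using step unfolding fact_sum_Suc pot_Suc[of _ "Suc m"] by (simp add: distrib_left)
  qed
qed

lemma pot_2_eq_fact_sum:
  assumes "2 \<le> m"
  shows "pot 2 (Suc m) = 2 * fact_sum m"
  using assms
proof (induction m rule: dec_induct)
  case base
  then show ?case by (simp add: pot_def pot_step_def fact_sum_def numeral_2_eq_2)
next
  case (step m)
  then have "pot_step 2 (Suc m) = 2 * fact (Suc m)"
    by (simp add: pot_step_def)
  then show ?case
    by (simp only: fact_sum_Suc pot_Suc[of _ "Suc m"] step.IH distrib_left)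
qed

section \<open>The upper bound\<close>

context walk_digraph
begin

text \<open>
  The potential of the height is fed into \<open>stationary_drift\<close>. Here \<open>a\<close> is the height of \<open>u\<close>, and
  the factor \<open>a\<close> on the right comes from the drift at \<open>u\<close>: besides the upward arcs \<open>u\<close> has at
  most \<open>a - 1\<close> others, since only \<open>a\<close> vertices, one of them \<open>u\<close>, are at height at most \<open>a\<close>.
\<close>
lemma stationary_ratio_le:
  assumes x: "stationary x" and nn: "\<And>v. v \<in> pverts D \<Longrightarrow> x v \<ge> 0"
    and u: "u \<in> pverts D" and w: "w \<in> pverts D" and uw: "u \<noteq> w"
  shows "\<exists>a\<ge>1. a < card (pverts D) \<and>
    x u * fact (a + 1) \<le> x w * (real a * pot a (card (pverts D)))"
proof -
  let ?n = "card (pverts D)"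
  obtain h where hw: "h w = ?n"
    and hlt: "\<forall>v\<in>pverts D - {w}. h v < ?n"
    and up: "\<forall>v\<in>pverts D - {w}. \<exists>y\<in>out_nbrs v. h y = Suc (h v)"
    and count: "\<forall>j. card {v \<in> pverts D. h v \<le> j} \<le> j"
    using height_function[OF w] by blast
  define a where "a = h u"
  have countA: "card {v \<in> A. h v \<le> j} \<le> j" if "A \<subseteq> pverts D" for A j
    by (rule order_trans[OF card_mono count[rule_format]]) (use that pair_finite_verts in auto)
  have a: "1 \<le> a"
  proof (rule ccontr)
    assume "\<not> 1 \<le> a"
    then have "u \<in> {v \<in> pverts D. h v \<le> 0}"
      using u by (simp add: a_def)
    then show False
      using spec[OF count, of 0] pair_finite_verts by auto
  qed
  define g where "g v = pot a (h v)" for v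
  define t where "t v = (\<Sum>y\<in>out_nbrs v. g y - g v) / real (card (out_nbrs v))" for v
  have t_nonneg: "t v \<ge> 0" if v: "v \<in> pverts D" "v \<noteq> w" for v
  proof (cases "h v \<le> a")
    \<comment> \<open>The potential vanishes up to height \<open>a\<close>, so it cannot decrease from \<open>v\<close>.\<close>
    case True
    then show ?thesis
      by (simp add: t_def g_def pot_eq_0 pot_nonneg sum_nonneg)
  next
    case False
    obtain y where y: "y \<in> out_nbrs v" "h y = Suc (h v)"
      using up v by blast
    let ?A = "out_nbrs v - {y}"
    have "(\<Sum>z\<in>?A. g v - g z) \<le> (\<Sum>j<h v. real j * pot_step a j)"
      unfolding g_def
    proof (rule sum_pot_deficit_le)
      show "card {x \<in> ?A. h x \<le> j} \<le> j" for j
        by (rule countA) (use out_nbrs_subset in auto)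
    qed (simp add: finite_out_nbrs)
    also have "\<dots> = g y - g v"
      using False y(2) by (simp add: weighted_pot_steps g_def pot_Suc)
    finally have "0 \<le> (g y - g v) - (\<Sum>z\<in>?A. g v - g z)" by simp
    also have "\<dots> = (\<Sum>z\<in>out_nbrs v. g z - g v)"
      unfolding sum.remove[OF finite_out_nbrs y(1)] by (simp add: sum_negf[symmetric])
    finally show ?thesis
      by (simp add: t_def)
  qed
  have t_u: "fact (a + 1) \<le> real a * t u"
  proof -
    obtain y where y: "y \<in> out_nbrs u" "h y = Suc a"
      using up u uw by (auto simp: a_def)
    let ?H = "{z \<in> out_nbrs u. a < h z}"
    let ?L = "{z \<in> out_nbrs u. h z \<le> a}"
    have fin: "finite ?H" "finite ?L"
      using finite_out_nbrs by auto
    have H: "1 \<le> card ?H"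
      using y fin(1) by (simp add: Suc_le_eq card_gt_0_iff) auto
    have "Suc (card ?L) = card (insert u ?L)"
      using fin(2) no_loops' by (subst card_insert_disjoint) (auto simp: out_nbrs_def)
    also have "\<dots> \<le> a"
      by (rule order_trans[OF card_mono count[rule_format, of a]])
        (use u out_nbrs_subset pair_finite_verts in \<open>auto simp: a_def\<close>)
    finally have L: "Suc (card ?L) \<le> a" .
    have deg: "card (out_nbrs u) = card ?H + card ?L"
      by (subst card_Un_disjoint[symmetric]) (use fin in \<open>auto intro: arg_cong[of _ _ card]\<close>)
    have "real (card ?H) * fact (a + 1) = (\<Sum>z\<in>?H. fact (a + 1))"
      by simp
    also have "\<dots> \<le> (\<Sum>z\<in>?H. g z)"
    proof (rule sum_mono)
      fix z assume "z \<in> ?H"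
      then have "pot a (Suc a) \<le> g z"
        unfolding g_def by (intro pot_mono) simp
      then show "fact (a + 1) \<le> g z"
        by (simp add: pot_Suc pot_eq_0 pot_step_def)
    qed
    also have "\<dots> \<le> (\<Sum>z\<in>out_nbrs u. g z)"
      by (rule sum_mono2) (auto simp: finite_out_nbrs g_def pot_nonneg)
    also have "\<dots> = t u * real (card (out_nbrs u))"
      using out_degree_pos[OF u] by (simp add: t_def g_def a_def pot_eq_0)
    finally have Ht: "real (card ?H) * fact (a + 1) \<le> t u * real (card (out_nbrs u))" .
    \<comment> \<open>Several upward arcs only help: \<open>k / (k + a - 1) \<ge> 1 / a\<close> for \<open>k \<ge> 1\<close>.\<close>
    have "card (out_nbrs u) \<le> card ?H + (a - 1)"
      using deg L by simp
    also have "\<dots> \<le> card ?H * a"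
    proof -
      have "(a - 1) * 1 \<le> (a - 1) * card ?H"
        using H by (rule mult_le_mono2)
      then show ?thesis
        using a H by (cases a) (simp_all add: algebra_simps)
    qed
    finally have "t u * real (card (out_nbrs u)) \<le> t u * real (card ?H * a)"
      using t_nonneg[OF u uw] by (intro mult_left_mono) (simp_all only: of_nat_le_iff)
    with Ht have "real (card ?H) * fact (a + 1) \<le> real (card ?H) * (real a * t u)"
      by (simp add: mult_ac)
    then show ?thesis
      using H by simp
  qed
  have t_w: "- pot a ?n \<le> t w"
  proof -
    have "(\<Sum>y\<in>out_nbrs w. - pot a ?n) \<le> (\<Sum>y\<in>out_nbrs w. g y - g w)"
      by (rule sum_mono) (simp add: g_def hw pot_nonneg)
    then show ?thesis
      using out_degree_pos[OF w] by (simp add: t_def field_simps)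
  qed
  have "0 = (\<Sum>v\<in>pverts D. x v * t v)"
    using stationary_drift[OF x, of g] by (simp add: t_def)
  also have "\<dots> = x u * t u + (x w * t w + (\<Sum>v\<in>pverts D - {u} - {w}. x v * t v))"
    using u w uw pair_finite_verts
    by (simp add: sum.remove[of "pverts D" u] sum.remove[of "pverts D - {u}" w])
  finally have "x u * t u + x w * t w \<le> 0"
    using sum_nonneg[of "pverts D - {u} - {w}" "\<lambda>v. x v * t v"] nn t_nonneg by simp
  moreover have "x w * - pot a ?n \<le> x w * t w"
    using t_w nn[OF w] by (rule mult_left_mono)
  ultimately have "x u * t u \<le> x w * pot a ?n" by simp
  then have "real a * (x u * t u) \<le> real a * (x w * pot a ?n)"
    by (rule mult_left_mono) simp
  moreover have "x u * fact (a + 1) \<le> x u * (real a * t u)"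
    using t_u nn[OF u] by (rule mult_left_mono)
  ultimately have "x u * fact (a + 1) \<le> x w * (real a * pot a ?n)"
    by (simp add: mult_ac)
  then show ?thesis
    using a hlt u uw by (auto simp: a_def)
qed

lemma principal_ratio_le:
  assumes n: "card (pverts D) = Suc m" and m: "2 \<le> m"
  shows "principal_ratio D \<le> 2 / 3 * fact_sum m"
proof -
  let ?\<phi> = "perron_vector D"
  have ne: "?\<phi> ` pverts D \<noteq> {}" and fin: "finite (?\<phi> ` pverts D)"
    using n pair_finite_verts by auto
  obtain u where u: "u \<in> pverts D" "Max (?\<phi> ` pverts D) = ?\<phi> u"
    using Max_in[OF fin ne] by auto
  obtain w where w: "w \<in> pverts D" "Min (?\<phi> ` pverts D) = ?\<phi> w"
    using Min_in[OF fin ne] by auto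
  have "?\<phi> u \<le> 2 / 3 * fact_sum m * ?\<phi> w"
  proof (cases "u = w")
    case True
    have "1 \<le> 2 / 3 * fact_sum m"
      using fact_sum_ge_linear[OF m] m by simp
    then show ?thesis
      using True mult_right_mono[of 1 "2 / 3 * fact_sum m" "?\<phi> w"] perron_vector_pos[OF w(1)]
      by simp
  next
    case False
    obtain a where a: "1 \<le> a" "a < Suc m"
      "?\<phi> u * fact (a + 1) \<le> ?\<phi> w * (real a * pot a (Suc m))"
      using stationary_ratio_le[OF stationary_perron_vector _ u(1) w(1) False]
        less_imp_le[OF perron_vector_pos] n by auto
    note a(3)
    also have "?\<phi> w * (real a * pot a (Suc m)) \<le> ?\<phi> w * (2 / 3 * fact (a + 1) * fact_sum m)"
      using pot_le_fact_sum[of a m] a m perron_vector_pos[OF w(1)]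
      by (intro mult_left_mono) simp_all
    finally have "?\<phi> u * fact (a + 1) \<le> (2 / 3 * fact_sum m * ?\<phi> w) * fact (a + 1)"
      by (simp add: mult_ac)
    then show ?thesis
      by (rule mult_right_le_imp_le) simp
  qed
  then show ?thesis
    using perron_vector_pos[OF w(1)] by (simp add: principal_ratio_def u(2) w(2) field_simps)
qed

end

section \<open>A digraph attaining the bound\<close>

text \<open>
  Vertex \<open>k\<close> has height \<open>k + 1\<close> and, for \<open>k < n - 1\<close>, out-degree \<open>k + 1\<close>: one arc up and
  all arcs down. The last vertex returns to \<open>0\<close>, where the potential is zero, which makes its
  drift as negative as possible.
\<close>
definition extremal_digraph :: "nat \<Rightarrow> nat pair_pre_digraph" where
  "extremal_digraph n = \<lparr>pverts = {..<n},
     parcs = {(k, l). k < n - 1 \<and> l \<noteq> k \<and> l \<le> Suc k} \<union> {(n - 1, 0)}\<rparr>"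

lemma extremal_digraph_simps:
  "pverts (extremal_digraph n) = {..<n}"
  "(k, l) \<in> parcs (extremal_digraph n) \<longleftrightarrow>
     k < n - 1 \<and> l \<noteq> k \<and> l \<le> Suc k \<or> k = n - 1 \<and> l = 0"
  by (auto simp: extremal_digraph_def)

lemma walk_digraph_extremal_digraph:
  assumes n: "n \<ge> 3"
  shows "walk_digraph (extremal_digraph n)"
proof -
  let ?D = "extremal_digraph n"
  interpret pair_digraph ?D
  proof
    show "finite (parcs ?D)"
      by (rule finite_subset[of _ "{..<n} \<times> {..<n}"])
        (use n in \<open>auto simp: extremal_digraph_simps\<close>)
  qed (use n in \<open>auto simp: extremal_digraph_simps\<close>)
  have up: "(u, v) \<in> rtrancl_on {..<n} (parcs ?D)" if "u \<le> v" "v < n" for u v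
    using that
  proof (induction v rule: dec_induct)
    case base
    then show ?case by simp
  next
    case (step v)
    show ?case
      by (rule rtrancl_on_into_rtrancl_on[of u v]) (use step in \<open>auto simp: extremal_digraph_simps\<close>)
  qed
  have "(u, v) \<in> rtrancl_on {..<n} (parcs ?D)" if "u < n" "v < n" for u v
  proof -
    have "(u, 0) \<in> rtrancl_on {..<n} (parcs ?D)"
      by (rule rtrancl_on_into_rtrancl_on[OF up[of u "n - 1"]])
        (use that in \<open>auto simp: extremal_digraph_simps\<close>)
    then show ?thesis
      using up[of 0 v] that by (auto intro: rtrancl_on_trans)
  qed
  then have "strongly_connected (with_proj ?D)"
    using n by (auto simp: strongly_connected_def reachable_def extremal_digraph_simps
        lessThan_empty_iff)
  then show ?thesis
    using n by unfold_locales (simp_all add: extremal_digraph_simps)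
qed

text \<open>
  When the vertices below are at heights \<open>1, \<dots>, k\<close>, the bound \<open>sum_pot_deficit_le\<close> is attained.
\<close>
lemma sum_pot_deficit_eq:
  "(\<Sum>l<k. pot a (Suc k) - pot a (Suc l)) = (\<Sum>j<Suc k. real j * pot_step a j)"
proof (induction k)
  case 0
  then show ?case by simp
next
  case (Suc k)
  have "(\<Sum>l<Suc k. pot a (Suc (Suc k)) - pot a (Suc l))
      = (\<Sum>l<Suc k. pot_step a (Suc k) + (pot a (Suc k) - pot a (Suc l)))"
    by (rule sum.cong) (simp_all add: pot_Suc)
  also have "\<dots> = real (Suc k) * pot_step a (Suc k)
      + (\<Sum>l<Suc k. pot a (Suc k) - pot a (Suc l))"
    by (simp only: sum.distrib sum_constant card_lessThan)
  also have "(\<Sum>l<Suc k. pot a (Suc k) - pot a (Suc l)) = (\<Sum>l<k. pot a (Suc k) - pot a (Suc l))"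
    by simp
  finally show ?case
    using Suc by simp
qed

text \<open>
  The potential for \<open>a = 2\<close> vanishes at \<open>0\<close> and \<open>1\<close> and is \<open>6\<close> at \<open>2\<close>, so its drift is \<open>0\<close> at
  \<open>0\<close> and \<open>3\<close> at \<open>1\<close>; at the vertices strictly between \<open>1\<close> and \<open>m\<close> the gain of the upward arc
  cancels the loss of the others. Only the entries at \<open>1\<close> and \<open>m\<close> remain in \<open>stationary_drift\<close>.
\<close>
lemma principal_ratio_extremal_digraph_ge:
  assumes m: "2 \<le> m"
  shows "2 / 3 * fact_sum m \<le> principal_ratio (extremal_digraph (Suc m))"
proof -
  let ?D = "extremal_digraph (Suc m)"
  interpret walk_digraph ?D
    using m by (intro walk_digraph_extremal_digraph) simp
  let ?\<phi> = "perron_vector ?D"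
  define g where "g k = pot 2 (Suc k)" for k
  define t where "t v = (\<Sum>y\<in>out_nbrs v. g y - g v) / real (card (out_nbrs v))" for v
  have nbrs: "out_nbrs k = insert (Suc k) {..<k}" if "k < m" for k
    using that by (auto simp: out_nbrs_def extremal_digraph_simps)
  have g0: "g 0 = 0" "g 1 = 0" "g 2 = 6"
    by (simp_all add: g_def pot_def pot_step_def numeral_2_eq_2 numeral_3_eq_3)
  have t0: "t 0 = 0"
    using m g0 by (simp add: t_def nbrs)
  have t1: "t 1 = 3"
    using m g0 by (simp add: t_def nbrs numeral_2_eq_2)
  have tk: "t k = 0" if "2 \<le> k" "k < m" for k
  proof -
    have "(\<Sum>y\<in>out_nbrs k. g y - g k) = (g (Suc k) - g k) - (\<Sum>l<k. g k - g l)"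
      using that by (simp add: nbrs sum_subtractf algebra_simps)
    also have "\<dots> = 0"
      using that unfolding g_def sum_pot_deficit_eq pot_Suc[of 2 "Suc k"]
      by (subst weighted_pot_steps) simp_all
    finally show ?thesis
      by (simp add: t_def)
  qed
  have tm: "t m = - g m"
  proof -
    have "out_nbrs m = {0}"
      by (auto simp: out_nbrs_def extremal_digraph_simps)
    then show ?thesis
      by (simp add: t_def g0)
  qed
  have "0 = (\<Sum>v\<in>{..<Suc m}. ?\<phi> v * t v)"
    using stationary_drift[OF stationary_perron_vector, of g]
    by (simp only: t_def extremal_digraph_simps)
  also have "\<dots> = (\<Sum>v\<in>{1, m}. ?\<phi> v * t v)"
  proof (rule sum.mono_neutral_right)
    show "\<forall>i\<in>{..<Suc m} - {1, m}. ?\<phi> i * t i = 0"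
    proof
      fix i assume "i \<in> {..<Suc m} - {1, m}"
      then have "i = 0 \<or> 2 \<le> i \<and> i < m" by auto
      then show "?\<phi> i * t i = 0"
        using t0 tk by auto
    qed
  qed (use m in auto)
  also have "\<dots> = ?\<phi> 1 * 3 - ?\<phi> m * (2 * fact_sum m)"
    using m t1 tm pot_2_eq_fact_sum[OF m] by (simp add: g_def)
  finally have eq: "?\<phi> 1 = 2 / 3 * fact_sum m * ?\<phi> m" by simp
  have pos: "?\<phi> v > 0" if "v \<le> m" for v
    using that by (intro perron_vector_pos) (simp add: extremal_digraph_simps)
  have "2 / 3 * fact_sum m = ?\<phi> 1 / ?\<phi> m"
    using eq pos[of m] by simp
  also have "\<dots> \<le> Max (?\<phi> ` pverts ?D) / Min (?\<phi> ` pverts ?D)"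
  proof (rule frac_le)
    show "?\<phi> 1 \<le> Max (?\<phi> ` pverts ?D)" "Min (?\<phi> ` pverts ?D) \<le> ?\<phi> m"
      using m by (auto simp: extremal_digraph_simps intro!: Max_ge Min_le)
    show "0 < Min (?\<phi> ` pverts ?D)"
      using pos m by (subst Min_gr_iff) (auto simp: extremal_digraph_simps lessThan_empty_iff)
    then show "0 \<le> Max (?\<phi> ` pverts ?D)"
      using \<open>?\<phi> 1 \<le> Max (?\<phi> ` pverts ?D)\<close> pos[of 1] m by simp
  qed
  finally show ?thesis
    by (simp add: principal_ratio_def)
qed

section \<open>The maximum and its asymptotics\<close>

theorem max_principal_ratio_eq:
  assumes m: "2 \<le> m"
  shows "max_principal_ratio (Suc m) = 2 / 3 * fact_sum m"
proof (rule antisym)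
  have "principal_ratio D \<le> 2 / 3 * fact_sum m" if "D \<in> sc_digraphs (Suc m)" for D
  proof -
    interpret walk_digraph D
      using that m
      by (auto simp: sc_digraphs_def walk_digraph_def walk_digraph_axioms_def)
    show ?thesis
      using that m by (intro principal_ratio_le) (simp_all add: sc_digraphs_def)
  qed
  then show "max_principal_ratio (Suc m) \<le> 2 / 3 * fact_sum m"
    unfolding max_principal_ratio_def
    using finite_sc_digraphs sc_digraphs_nonempty[of "Suc m"] by (subst Max_le_iff) auto
next
  interpret walk_digraph "extremal_digraph (Suc m)"
    using m by (intro walk_digraph_extremal_digraph) simp
  have "extremal_digraph (Suc m) \<in> sc_digraphs (Suc m)"
    using sc pair_digraph_axioms by (simp add: sc_digraphs_def extremal_digraph_simps)
  then have "principal_ratio (extremal_digraph (Suc m)) \<le> max_principal_ratio (Suc m)"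
    unfolding max_principal_ratio_def by (intro Max_ge) (simp_all add: finite_sc_digraphs)
  then show "2 / 3 * fact_sum m \<le> max_principal_ratio (Suc m)"
    using principal_ratio_extremal_digraph_ge[OF m] by simp
qed

text \<open>
  All terms below the last one add up to at most \<open>2 (m - 1)!\<close>, a fraction \<open>2 / m\<close> of \<open>m!\<close>.
\<close>
lemma fact_sum_bounds:
  assumes "1 \<le> m"
  shows "fact m \<le> fact_sum m" and "fact_sum m \<le> fact m * (1 + 2 / real m)"
proof -
  show "fact m \<le> fact_sum m"
    using assms unfolding fact_sum_def by (intro member_le_sum) auto
  have "fact_sum (Suc k) \<le> fact (Suc k) + 2 * fact k" for k
  proof (induction k)
    case 0
    then show ?case by (simp add: fact_sum_def)
  next
    case (Suc k)
    show ?case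
    proof (cases "k = 0")
      case True
      then show ?thesis by (simp add: fact_sum_def)
    next
      case False
      then have "(2 :: real) * fact k \<le> fact (Suc k)"
        unfolding fact_Suc by (intro mult_right_mono) simp_all
      then show ?thesis
        using Suc unfolding fact_sum_Suc[of "Suc k"] by (simp del: fact_Suc)
    qed
  qed
  moreover obtain k where k: "m = Suc k"
    using assms by (cases m) auto
  moreover have "fact (Suc k) * (1 + 2 / real (Suc k)) = fact (Suc k) + 2 * fact k"
    by (simp add: field_simps)
  ultimately show "fact_sum m \<le> fact m * (1 + 2 / real m)"
    by simp
qed

theorem theorem1:
  shows "\<exists>\<epsilon> :: nat \<Rightarrow> real. \<epsilon> \<in> o(\<lambda>_. 1) \<and>
    (\<forall>n\<ge>3. max_principal_ratio n = (2 / 3 + \<epsilon> n) * fact (n - 1))"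
proof -
  define \<epsilon> where "\<epsilon> n = 2 / 3 * (fact_sum (n - 1) / fact (n - 1) - 1)" for n
  have "\<epsilon> \<longlonglongrightarrow> 0"
  proof (rule tendsto_sandwich)
    have bounds: "0 \<le> \<epsilon> n \<and> \<epsilon> n \<le> 4 / 3 / real (n - 1)" if n: "n \<ge> 2" for n
    proof -
      obtain m where m: "n = Suc m" "1 \<le> m"
        using n by (cases n) auto
      show ?thesis
        using fact_sum_bounds[OF m(2)] m by (simp add: \<epsilon>_def field_simps)
    qed
    show "\<forall>\<^sub>F n in sequentially. 0 \<le> \<epsilon> n" "\<forall>\<^sub>F n in sequentially. \<epsilon> n \<le> 4 / 3 / real (n - 1)"
      using bounds by (auto intro: eventually_sequentiallyI[of 2])
    have "(\<lambda>n. 4 / 3 / real n) \<longlonglongrightarrow> 0"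
      by (rule lim_const_over_n)
    then show "(\<lambda>n. 4 / 3 / real (n - 1)) \<longlonglongrightarrow> 0"
      by (subst filterlim_sequentially_Suc[symmetric]) simp
  qed simp
  then have "\<epsilon> \<in> o(\<lambda>_. 1)"
    by (intro smalloI_tendsto) simp_all
  moreover have "max_principal_ratio n = (2 / 3 + \<epsilon> n) * fact (n - 1)" if "n \<ge> 3" for n
    using max_principal_ratio_eq[of "n - 1"] that by (simp add: \<epsilon>_def field_simps)
  ultimately show ?thesis by blast
qed

end
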